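(* There is a constant $C>0$, independent of the mesh size $h$, such that for every $u_h\in U_h$ its boundary lifting $\tilde w_h\in V_h$ satisfies $$\|\tilde w_h\|_{L_1(\Omega)}\le C h\,\|u_h\|_{L_1(\Gamma)}.$$
   Context: $\Omega\subset\mathbb{R}^2$ is a bounded convex polygonal domain with boundary $\Gamma$. $\mathcal{T}_h$ denotes a member of a family of regular (conforming) triangulations of $\Omega$ into closed triangles, all of whose interior angles are bounded below by a universal constant $\rho>0$ (shape regularity); $h=\max_{T\in\mathcal{T}_h}\mathrm{diam}(T)$. $\mathcal{E}_h$, $\mathcal{E}_h^i$, $\mathcal{E}_h^b$ are the sets of all, interior, and boundary edges; $m_e$ is the midpoint of the edge $e$. The Crouzeix-Raviart space is $V_h=\{v_h\in L_2(\Omega): v_h|_T\in\mathbb{P}_1(T)\ \forall T\in\mathcal{T}_h,\ v_h \text{ continuous at } m_e\ \forall e\in\mathcal{E}_h\}$. The discrete control space is $U_h=\{u_h\in L_2(\Gamma): u_h|_e\in\mathbb{P}_0(e)\ \forall e\in\mathcal{E}_h^b\}$. For $u_h\in U_h$, its boundary lifting $\tilde w_h\in V_h$ is the unique element of $V_h$ with $\tilde w_h(m_e)=0$ for all $e\in\mathcal{E}_h^i$ and $\tilde w_h(m_e)=u_h|_e$ for all $e\in\mathcal{E}_h^b$. *)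

theory Defs
  imports "HOL-Analysis.Analysis"
begin

section \<open>Domain and triangulations\<close>

definition convex_polygonal_domain :: "(real^2) set \<Rightarrow> bool" where
  "convex_polygonal_domain \<Omega> \<longleftrightarrow>
     open \<Omega> \<and> \<Omega> \<noteq> {} \<and> bounded \<Omega> \<and> convex \<Omega> \<and> polytope (closure \<Omega>)"

definition vertex_angle :: "real^2 \<Rightarrow> real^2 \<Rightarrow> real^2 \<Rightarrow> real" where
  "vertex_angle a b c = arccos (((b - a) \<bullet> (c - a)) / (norm (b - a) * norm (c - a)))"

text \<open>The library predicate \<^const>\<open>triangulation\<close> requires any two members to meet in a common
  (possibly empty) face, that is, conformity. In the angle condition, \<open>a\<close>, \<open>b\<close>, \<open>c\<close> range over
  all orderings of the vertices of the nondegenerate triangle \<open>T\<close>.\<close>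

definition regular_triangulation :: "real \<Rightarrow> (real^2) set \<Rightarrow> (real^2) set set \<Rightarrow> bool" where
  "regular_triangulation \<rho> \<Omega> \<T> \<longleftrightarrow>
     triangulation \<T> \<and> (\<forall>T\<in>\<T>. 2 simplex T) \<and> \<Union>\<T> = closure \<Omega> \<and>
     (\<forall>T\<in>\<T>. \<forall>a b c. T = convex hull {a, b, c} \<longrightarrow> \<rho> \<le> vertex_angle a b c)"

definition mesh_size :: "(real^2) set set \<Rightarrow> real" where
  "mesh_size \<T> = Max (diameter ` \<T>)"

definition edges :: "(real^2) set set \<Rightarrow> (real^2) set set" where
  "edges \<T> = {e. \<exists>T\<in>\<T>. e edge_of T}"

definition boundary_edges :: "(real^2) set \<Rightarrow> (real^2) set set \<Rightarrow> (real^2) set set" where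
  "boundary_edges \<Omega> \<T> = {e \<in> edges \<T>. e \<subseteq> frontier \<Omega>}"

definition interior_edges :: "(real^2) set \<Rightarrow> (real^2) set set \<Rightarrow> (real^2) set set" where
  "interior_edges \<Omega> \<T> = edges \<T> - boundary_edges \<Omega> \<T>"

definition edge_midpoint :: "(real^2) set \<Rightarrow> real^2" where
  "edge_midpoint e = (THE m. \<exists>a b. e = closed_segment a b \<and> m = midpoint a b)"

lemma edge_midpoint_closed_segment [simp]:
  "edge_midpoint (closed_segment a b) = midpoint a b"
  unfolding edge_midpoint_def
  by (rule the_equality) (auto simp: closed_segment_eq doubleton_eq_iff midpoint_sym)


section \<open>Arc length on the boundary\<close>

text \<open>\<open>arc_length e A\<close> is the length of the part of the segment \<open>e\<close> lying in the Borel set \<open>A\<close>;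
  the choice of the orientation of \<open>e\<close> is immaterial by the lemma below.\<close>

definition arc_length :: "(real^2) set \<Rightarrow> (real^2) set \<Rightarrow> ennreal" where
  "arc_length e A =
     (case (SOME (a, b). e = closed_segment a b) of (a, b) \<Rightarrow>
        ennreal (dist a b) * emeasure lborel ({0..1} \<inter> linepath a b -` A))"

lemma arc_length_closed_segment:
  assumes "A \<in> sets borel"
  shows "arc_length (closed_segment a b) A =
           ennreal (dist a b) * emeasure lborel ({0..1} \<inter> linepath a b -` A)"
proof -
  obtain c d where cd: "(SOME (c, d). closed_segment a b = closed_segment c d) = (c, d)"
    by fastforce
  have "case (SOME (c, d). closed_segment a b = closed_segment c d) of
          (c, d) \<Rightarrow> closed_segment a b = closed_segment c d"
    by (rule someI_ex) auto
  with cd have "{a, b} = {c, d}"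
    by (simp add: closed_segment_eq)
  moreover have "emeasure lborel ({0..1} \<inter> linepath a b -` A) =
                 emeasure lborel ({0..1} \<inter> linepath b a -` A)"
  proof -
    have meas: "linepath x y \<in> borel_measurable borel" for x y :: "real^2"
      unfolding linepath_def by measurable
    have "({0..1} \<inter> linepath a b -` A) \<in> sets borel"
      using measurable_sets_borel[OF meas assms] by auto
    moreover have "(lborel :: real measure) = distr lborel borel (\<lambda>x. 1 + (-1) * x)"
      using lborel_distr_uminus lborel_distr_plus[of "1::real"]
      by (subst lborel_real_affine[of "-1" 1]) (simp_all add: density_1)
    moreover have "(\<lambda>x::real. 1 + (-1) * x) \<in> measurable lborel borel"
      by measurable
    ultimately have "emeasure lborel ({0..1} \<inter> linepath a b -` A) =
        emeasure lborel ((\<lambda>x::real. 1 + (-1) * x) -` ({0..1} \<inter> linepath a b -` A) \<inter> space lborel)"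
      using emeasure_distr by metis
    also have "(\<lambda>x::real. 1 + (-1) * x) -` ({0..1} \<inter> linepath a b -` A) \<inter> space lborel =
               {0..1} \<inter> linepath b a -` A"
      by (auto simp: linepath_def algebra_simps)
    finally show ?thesis .
  qed
  ultimately show ?thesis
    unfolding arc_length_def cd by (auto simp: doubleton_eq_iff dist_commute)
qed

text \<open>Arc length on \<open>\<Gamma> = frontier \<Omega>\<close>, summed over the sides of the polygon.\<close>

definition boundary_measure :: "(real^2) set \<Rightarrow> (real^2) measure" where
  "boundary_measure \<Omega> =
     measure_of (frontier \<Omega>) (sets (restrict_space borel (frontier \<Omega>)))
       (\<lambda>A. \<Sum>F | F edge_of closure \<Omega>. arc_length F A)"

lemma space_boundary_measure [simp]: "space (boundary_measure \<Omega>) = frontier \<Omega>"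
  using sets.space_closed[of "restrict_space borel (frontier \<Omega>)"]
  by (simp add: boundary_measure_def space_measure_of_conv)

lemma sets_boundary_measure [simp]:
  "sets (boundary_measure \<Omega>) = sets (restrict_space borel (frontier \<Omega>))"
  using sets.sets_measure_of_eq[of "restrict_space borel (frontier \<Omega>)"]
  by (simp add: boundary_measure_def space_restrict_space)

lemma edge_of_polytope_segment:
  fixes P :: "(real^2) set"
  assumes "polytope P" "F edge_of P"
  obtains a b where "a \<noteq> b" "F = closed_segment a b"
proof -
  have F: "F face_of P" "aff_dim F = 1"
    using assms(2) by (auto simp: edge_of_def)
  have "compact F" "convex F"
    using F assms(1) by (auto simp: face_of_imp_convex polytope_imp_compact
        face_of_polytope_polytope)
  moreover have "collinear F"
    using F by (simp add: collinear_aff_dim)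
  moreover have "F \<noteq> {}" using F by auto
  ultimately obtain a b where "F = closed_segment a b"
    by (metis compact_convex_collinear_segment)
  with F show ?thesis
    by (intro that[of a b]) auto
qed

lemma emeasure_boundary_measure:
  assumes "convex_polygonal_domain \<Omega>" "A \<in> sets borel" "A \<subseteq> frontier \<Omega>"
  shows "emeasure (boundary_measure \<Omega>) A = (\<Sum>F | F edge_of closure \<Omega>. arc_length F A)"
proof (rule emeasure_measure_of[OF boundary_measure_def])
  have poly: "polytope (closure \<Omega>)"
    using assms(1) by (simp add: convex_polygonal_domain_def)
  show "sets (restrict_space borel (frontier \<Omega>)) \<subseteq> Pow (frontier \<Omega>)"
    using sets.space_closed[of "restrict_space borel (frontier \<Omega>)"]
    by (simp add: space_restrict_space)
  show "A \<in> sets (boundary_measure \<Omega>)"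
    using assms by (simp add: sets_restrict_space_iff)
  have emp: "arc_length F {} = 0" for F
    by (auto simp: arc_length_def split: prod.split)
  show "positive (sets (boundary_measure \<Omega>)) (\<lambda>A. \<Sum>F | F edge_of closure \<Omega>. arc_length F A)"
    by (simp add: positive_def emp)
  show "countably_additive (sets (boundary_measure \<Omega>))
          (\<lambda>A. \<Sum>F | F edge_of closure \<Omega>. arc_length F A)"
  proof (rule countably_additiveI)
    fix X :: "nat \<Rightarrow> (real^2) set"
    assume X: "range X \<subseteq> sets (boundary_measure \<Omega>)" "disjoint_family X"
    have Xb: "X i \<in> sets borel" for i
      using X(1) by (auto simp: sets_restrict_space_iff image_subset_iff)
    have "(\<Sum>i. arc_length F (X i)) = arc_length F (\<Union>i. X i)" if side: "F edge_of closure \<Omega>" for F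
    proof -
      obtain a b where F: "F = closed_segment a b"
        using edge_of_polytope_segment[OF poly side] by blast
      have meas: "linepath a b \<in> borel_measurable borel"
        unfolding linepath_def by measurable
      have "range (\<lambda>i. {0..1} \<inter> linepath a b -` X i) \<subseteq> sets lborel"
        using measurable_sets_borel[OF meas Xb] by auto
      moreover have "disjoint_family (\<lambda>i. {0..1} \<inter> linepath a b -` X i)"
        using X(2) by (fastforce simp: disjoint_family_on_def)
      ultimately have "(\<Sum>i. emeasure lborel ({0..1} \<inter> linepath a b -` X i)) =
          emeasure lborel (\<Union>i. {0..1} \<inter> linepath a b -` X i)"
        by (rule suminf_emeasure)
      also have "(\<Union>i. {0..1} \<inter> linepath a b -` X i) = {0..1} \<inter> linepath a b -` (\<Union>i. X i)"
        by auto
      finally show ?thesis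
        using Xb by (simp add: F arc_length_closed_segment)
    qed
    then show "(\<Sum>i. \<Sum>F | F edge_of closure \<Omega>. arc_length F (X i)) =
               (\<Sum>F | F edge_of closure \<Omega>. arc_length F (\<Union>i. X i))"
      by (simp add: suminf_sum)
  qed
qed


section \<open>Function spaces\<close>

text \<open>Elements of \<open>L\<^sub>1\<close> and \<open>L\<^sub>2\<close> are represented by functions, with identities on triangles and
  edges holding almost everywhere.\<close>

definition in_L2 :: "'a measure \<Rightarrow> ('a \<Rightarrow> real) \<Rightarrow> bool" where
  "in_L2 M f \<longleftrightarrow> f \<in> borel_measurable M \<and> integrable M (\<lambda>x. (f x)\<^sup>2)"

definition L1_norm :: "'a measure \<Rightarrow> ('a \<Rightarrow> real) \<Rightarrow> real" where
  "L1_norm M f = (\<integral>x. \<bar>f x\<bar> \<partial>M)"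

text \<open>Continuity at a midpoint \<open>m\<close> says that the values in \<open>\<Omega>\<close> tend to the value at \<open>m\<close>.
  For a boundary edge, where \<open>m \<notin> \<Omega>\<close>, this fixes \<open>v m\<close> as the value of the continuous extension.\<close>

definition CR_space :: "(real^2) set \<Rightarrow> (real^2) set set \<Rightarrow> (real^2 \<Rightarrow> real) set" where
  "CR_space \<Omega> \<T> =
     {v. in_L2 (lebesgue_on \<Omega>) v \<and>
         (\<forall>T\<in>\<T>. \<exists>g d. AE x in lebesgue_on (T \<inter> \<Omega>). v x = g \<bullet> x + d) \<and>
         (\<forall>e\<in>edges \<T>. (v \<longlongrightarrow> v (edge_midpoint e)) (at (edge_midpoint e) within \<Omega>))}"

definition control_space :: "(real^2) set \<Rightarrow> (real^2) set set \<Rightarrow> (real^2 \<Rightarrow> real) set" where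
  "control_space \<Omega> \<T> =
     {u. in_L2 (boundary_measure \<Omega>) u \<and>
         (\<forall>e\<in>boundary_edges \<Omega> \<T>. \<exists>c. AE x in boundary_measure \<Omega>. x \<in> e \<longrightarrow> u x = c)}"

definition boundary_lifting ::
  "(real^2) set \<Rightarrow> (real^2) set set \<Rightarrow> (real^2 \<Rightarrow> real) \<Rightarrow> (real^2 \<Rightarrow> real) \<Rightarrow> bool" where
  "boundary_lifting \<Omega> \<T> u w \<longleftrightarrow>
     w \<in> CR_space \<Omega> \<T> \<and>
     (\<forall>e\<in>interior_edges \<Omega> \<T>. w (edge_midpoint e) = 0) \<and>
     (\<forall>e\<in>boundary_edges \<Omega> \<T>. AE x in boundary_measure \<Omega>. x \<in> e \<longrightarrow> u x = w (edge_midpoint e))"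

end

theory Submission
  imports Defs
begin

text \<open>The estimate holds with \<open>C = 1 / 2\<close> and is a local computation. On a triangle \<open>T\<close> the lifting \<open>w\<close> is affine,
  hence bounded by the sum of its absolute midpoint values, of which only those on boundary edges of the mesh are
  nonzero (\<open>boundary_lifting_le_on_triangle\<close>). If \<open>e\<close> is an edge of \<open>T\<close>, then the area of \<open>T\<close> is at most
  \<open>h / 2\<close> times the length of \<open>e\<close> (\<open>content_triangle_le_edge\<close>). Summation over the triangles thus bounds the
  \<open>L\<^sub>1\<close> norm of \<open>w\<close> by \<open>h / 2\<close> times a sum over pairs of a triangle and one of its boundary edges \<open>e\<close>, of
  the length of \<open>e\<close> times \<open>\<bar>w m\<bar>\<close>, where \<open>m\<close> is the midpoint of \<open>e\<close>.

  Two facts turn this sum into the \<open>L\<^sub>1\<close> norm of the control. A boundary edge belongs to one triangle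
  only, because all triangles at that edge lie on the same side of a supporting line of the convex domain
  (\<open>boundary_edge_in_unique_triangle\<close>). Moreover distinct edges share at most endpoints, and the control is almost
  everywhere equal to \<open>w m\<close> on \<open>e\<close>, so that its norm is at least the sum of the lengths times \<open>\<bar>w m\<bar>\<close>
  (\<open>control_L1_norm_ge\<close>).

  The functions are known only almost everywhere and arc length is defined through the sides of the polygon rather
  than the edges of the mesh. The remaining lemmas bridge these gaps: \<open>continuous_limit_eq_AE_representative\<close>
  identifies the midpoint values of \<open>w\<close> with those of its affine representative, and
  \<open>boundary_segment_in_side\<close> places every boundary edge inside a side.\<close>

section \<open>Triangles and their edges\<close>

lemma diameter_closed_segment:
  fixes a b :: "'a::euclidean_space"
  shows "diameter (closed_segment a b) = dist a b"
proof (rule antisym)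
  show "diameter (closed_segment a b) \<le> dist a b"
  proof (rule diameter_le)
    fix x y assume "x \<in> closed_segment a b" "y \<in> closed_segment a b"
    then obtain s t where st: "s \<in> {0..1}" "t \<in> {0..1}" "x = linepath a b s" "y = linepath a b t"
      unfolding linepath_image_01[symmetric] by blast
    have "x - y = (t - s) *\<^sub>R (a - b)"
      unfolding st by (simp add: linepath_def algebra_simps)
    then show "norm (x - y) \<le> dist a b"
      using st(1,2) by (auto simp: dist_norm intro!: mult_left_le_one_le)
  qed simp
  show "dist a b \<le> diameter (closed_segment a b)"
    by (rule diameter_bounded_bound) (auto simp: bounded_closed_segment)
qed

lemma triangle_obtain_vertices:
  fixes T :: "(real^2) set"
  assumes "2 simplex T"
  obtains a b c where "T = convex hull {a, b, c}" "\<not> collinear {a, b, c}"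
proof -
  obtain C where C: "\<not> affine_dependent C" "int (card C) = 3" "T = convex hull C"
    using assms unfolding simplex_def by auto
  then have "card C = 3" by simp
  then obtain a b c where "C = {a, b, c}" "a \<noteq> b" "b \<noteq> c" "a \<noteq> c"
    by (auto simp: card_3_iff)
  with C show ?thesis
    by (intro that[of a b c]) (auto simp: collinear_3_eq_affine_dependent)
qed

text \<open>The faces of a simplex are the hulls of subsets of its vertices, and those of dimension one come from the pairs.\<close>

lemma edge_of_triangle_iff:
  fixes a b c :: "real^2"
  assumes "\<not> collinear {a, b, c}"
  shows "e edge_of convex hull {a, b, c} \<longleftrightarrow>
           e = closed_segment a b \<or> e = closed_segment b c \<or> e = closed_segment c a"
proof -
  have dist: "a \<noteq> b" "b \<noteq> c" "a \<noteq> c" and ind: "\<not> affine_dependent {a, b, c}"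
    using assms by (auto simp: collinear_3_eq_affine_dependent)
  have face: "F face_of convex hull {a, b, c} \<longleftrightarrow> (\<exists>V\<subseteq>{a, b, c}. F = convex hull V)" for F
    using face_of_convex_hull_affine_independent[OF ind] by blast
  have dim: "aff_dim (convex hull V) = int (card V) - 1" if "V \<subseteq> {a, b, c}" for V
    using affine_independent_subset[OF ind that] by (simp add: aff_dim_convex_hull aff_dim_affine_independent)
  show ?thesis
  proof
    assume "e edge_of convex hull {a, b, c}"
    then obtain V where V: "V \<subseteq> {a, b, c}" "e = convex hull V" "aff_dim e = 1"
      unfolding edge_of_def face by blast
    then have "card V = 2" using dim by auto
    then obtain x y where "V = {x, y}" "x \<noteq> y" by (meson card_2_iff)
    with V have "V = {a, b} \<or> V = {b, c} \<or> V = {c, a}" by auto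
    with V(2) show "e = closed_segment a b \<or> e = closed_segment b c \<or> e = closed_segment c a"
      by (auto simp: segment_convex_hull)
  next
    assume "e = closed_segment a b \<or> e = closed_segment b c \<or> e = closed_segment c a"
    then obtain V where V: "V \<in> {{a, b}, {b, c}, {c, a}}" "e = convex hull V"
      unfolding segment_convex_hull by blast
    then have "V \<subseteq> {a, b, c}" "card V = 2"
      using dist by auto
    then show "e edge_of convex hull {a, b, c}"
      using V(2) dim unfolding edge_of_def face by auto
  qed
qed

lemma edge_of_triangle_obtain_vertices:
  fixes T :: "(real^2) set"
  assumes "2 simplex T" "e edge_of T"
  obtains a b c where "e = closed_segment a b" "T = convex hull {a, b, c}" "\<not> collinear {a, b, c}"
proof -
  obtain a b c where T: "T = convex hull {a, b, c}" "\<not> collinear {a, b, c}"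
    using triangle_obtain_vertices[OF assms(1)] .
  then consider "e = closed_segment a b" | "e = closed_segment b c" | "e = closed_segment c a"
    using assms(2) edge_of_triangle_iff by blast
  then show ?thesis
  proof cases
    case 1
    with T show ?thesis using that[of a b c] by simp
  next
    case 2
    with T show ?thesis using that[of b c a] by (simp add: insert_commute)
  next
    case 3
    with T show ?thesis using that[of c a b] by (simp add: insert_commute)
  qed
qed

text \<open>The height over a side is at most the diameter.\<close>

lemma content_triangle_le_side:
  fixes a b c :: "real^2"
  shows "measure lebesgue (convex hull {a, b, c}) \<le> diameter (convex hull {a, b, c}) * dist a b / 2"
proof -
  let ?p = "c - a" and ?q = "b - a"
  \<comment> \<open>Twice the area is the planar cross product of two sides, which the norms bound by Lagrange's identity.\<close>
  have "\<bar>?p$1 * ?q$2 - ?q$1 * ?p$2\<bar> \<le> norm ?p * norm ?q"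
  proof (rule power2_le_imp_le)
    have "(?p$1 * ?q$2 - ?q$1 * ?p$2)\<^sup>2 + (?p$1 * ?q$1 + ?p$2 * ?q$2)\<^sup>2 = ((?p$1)\<^sup>2 + (?p$2)\<^sup>2) * ((?q$1)\<^sup>2 + (?q$2)\<^sup>2)"
      by algebra
    moreover have "(norm x)\<^sup>2 = (x$1)\<^sup>2 + (x$2)\<^sup>2" for x :: "real^2"
      by (simp add: norm_vec_def L2_set_def sum_2)
    ultimately show "\<bar>?p$1 * ?q$2 - ?q$1 * ?p$2\<bar>\<^sup>2 \<le> (norm ?p * norm ?q)\<^sup>2"
      unfolding power_mult_distrib power2_abs by (smt (verit) zero_le_power2)
  qed simp
  also have "norm ?p \<le> diameter (convex hull {a, b, c})"
    using diameter_bounded_bound[of "convex hull {a, b, c}" c a]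
    by (simp add: hull_inc finite_imp_bounded bounded_convex_hull dist_norm)
  finally have "\<bar>?p$1 * ?q$2 - ?q$1 * ?p$2\<bar> \<le> diameter (convex hull {a, b, c}) * dist a b"
    by (simp add: dist_norm norm_minus_commute mult_right_mono)
  moreover have "convex hull {a, b, c} \<in> sets lborel"
    by (simp add: compact_convex_hull finite_imp_compact borel_compact)
  ultimately show ?thesis
    by (simp add: content_triangle)
qed

lemma content_triangle_le_edge:
  fixes T :: "(real^2) set"
  assumes "2 simplex T" "e edge_of T"
  shows "measure lebesgue T \<le> diameter T * diameter e / 2"
proof -
  obtain a b c where "e = closed_segment a b" "T = convex hull {a, b, c}"
    using edge_of_triangle_obtain_vertices[OF assms] .
  then show ?thesis
    using content_triangle_le_side[of a b c] by (simp add: diameter_closed_segment)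
qed

text \<open>On a triangle the affine function with value one at one midpoint and zero at the other two is
  \<open>1 - 2 * t\<close>, where \<open>t\<close> is the barycentric coordinate of the opposite vertex. It stays between \<open>-1\<close>
  and \<open>1\<close>.\<close>

lemma affine_le_midpoint_values:
  fixes g a b c x :: "'a::real_inner" and d :: real
  assumes "x \<in> convex hull {a, b, c}"
  defines "l \<equiv> \<lambda>x. g \<bullet> x + d"
  shows "\<bar>l x\<bar> \<le> \<bar>l (midpoint a b)\<bar> + \<bar>l (midpoint b c)\<bar> + \<bar>l (midpoint c a)\<bar>"
proof -
  obtain u v w where x: "x = u *\<^sub>R a + v *\<^sub>R b + w *\<^sub>R c" and
    uvw: "0 \<le> u" "0 \<le> v" "0 \<le> w" "u + v + w = 1"
    using assms(1) unfolding convex_hull_3 by blast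
  let ?p = "l (midpoint a b)" and ?q = "l (midpoint b c)" and ?r = "l (midpoint c a)"
  \<comment> \<open>The factors are the Crouzeix-Raviart basis functions, written in the barycentric coordinates of \<open>x\<close>.\<close>
  have "l x = (1 - 2 * w) * ?p + (1 - 2 * u) * ?q + (1 - 2 * v) * ?r"
  proof -
    have u: "u = 1 - v - w" using uvw by simp
    show ?thesis
      unfolding x l_def midpoint_def u by (simp add: inner_add_right) algebra
  qed
  moreover have "\<bar>(1 - 2 * t) * y\<bar> \<le> \<bar>y\<bar>" if "0 \<le> t" "t \<le> 1" for t y :: real
    unfolding abs_mult using that by (intro mult_left_le_one_le) auto
  ultimately show ?thesis
    using uvw by (smt (verit))
qed

section \<open>Edges of a triangulation\<close>

lemma edges_obtain_segment:
  assumes "\<forall>T\<in>\<T>. 2 simplex T" "e \<in> edges \<T>"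
  obtains a b where "a \<noteq> b" "e = closed_segment a b"
  using assms edge_of_polytope_segment simplex_imp_polytope unfolding edges_def by blast

lemma finite_polytope_edges:
  assumes "polytope P"
  shows "finite {F. F edge_of P}"
  using finite_polytope_faces[OF assms] by (rule rev_finite_subset) (auto simp: edge_of_def)

lemma finite_edges:
  assumes "finite \<T>" "\<forall>T\<in>\<T>. 2 simplex T"
  shows "finite (edges \<T>)"
proof -
  have "edges \<T> = (\<Union>T\<in>\<T>. {e. e edge_of T})"
    by (auto simp: edges_def)
  then show ?thesis
    using assms by (auto intro!: finite_polytope_edges simplex_imp_polytope)
qed

text \<open>Two edges with a common relative interior point both lie in the intersection of their triangles. By
  conformity they are faces of that one convex set, and faces with overlapping relative interiors coincide. Endpoints
  are excluded because distinct edges may share a vertex.\<close>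

lemma distinct_edges_rel_interior_disjoint:
  assumes "triangulation \<T>" "e \<in> edges \<T>" "e' \<in> edges \<T>" "e \<noteq> e'"
  shows "rel_interior e \<inter> rel_interior e' = {}"
proof (rule ccontr)
  assume ne: "rel_interior e \<inter> rel_interior e' \<noteq> {}"
  obtain T T' where T: "T \<in> \<T>" "e face_of T" and T': "T' \<in> \<T>" "e' face_of T'"
    using assms(2,3) by (auto simp: edges_def edge_of_def)
  have F: "T \<inter> T' face_of T" "T \<inter> T' face_of T'"
    using assms(1) T(1) T'(1) unfolding triangulation_def by (blast, metis Int_commute)
  have sub: "e \<subseteq> T" "e' \<subseteq> T'"
    using T T' face_of_imp_subset by blast+
  have "e \<subseteq> T \<inter> T'" "e' \<subseteq> T \<inter> T'"
    using subset_of_face_of[OF F(1) sub(1)] subset_of_face_of[OF F(2) sub(2)] ne sub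
      rel_interior_subset[of e] rel_interior_subset[of e'] by blast+
  then have "e face_of T \<inter> T'" "e' face_of T \<inter> T'"
    using T T' by (auto intro: face_of_subset)
  then show False
    using face_of_eq ne assms(4) by blast
qed

text \<open>The functional \<open>n\<close> expresses that \<open>c\<close> and \<open>p\<close> lie strictly on the same side of the line through \<open>a\<close>
  and \<open>b\<close>. Then the ray from the midpoint of that edge towards \<open>p\<close> starts inside the triangle. The point \<open>p\<close>
  can thus serve several triangles over the same edge at once.\<close>

lemma midpoint_ray_enters_triangle:
  fixes a b c n p :: "real^2"
  assumes "\<not> collinear {a, b, c}" "n \<bullet> a = n \<bullet> b" "n \<bullet> a < n \<bullet> c" "n \<bullet> a < n \<bullet> p"
  shows "\<exists>\<delta>>0. \<forall>t. 0 < t \<and> t < \<delta> \<longrightarrow>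
           midpoint a b + t *\<^sub>R (p - midpoint a b) \<in> interior (convex hull {a, b, c})"
proof -
  have "\<not> affine_dependent {a, b, c}" "card {a, b, c} = 3"
    using assms(1) by (auto simp: collinear_3_eq_affine_dependent)
  then have "affine hull {a, b, c} = UNIV"
    by (intro affine_independent_span_eq) auto
  then have "p \<in> affine hull {a, b, c}"
    by simp
  then obtain u v w where p: "p = u *\<^sub>R a + v *\<^sub>R b + w *\<^sub>R c" and sum: "u + v + w = 1"
    unfolding affine_hull_3 by blast
  \<comment> \<open>Only the coordinate of the apex \<open>c\<close> needs a sign: those of \<open>a\<close> and \<open>b\<close> start from \<open>1 / 2\<close> at the midpoint.\<close>
  have "n \<bullet> p - n \<bullet> a = w * (n \<bullet> c - n \<bullet> a)"
  proof -
    have u: "u = 1 - v - w" using sum by simp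
    show ?thesis unfolding p u by (simp add: inner_add_right assms(2) algebra_simps)
  qed
  then have "w > 0"
    using assms(3,4) by (metis diff_gt_0_iff_gt zero_less_mult_pos2)
  have "midpoint a b + t *\<^sub>R (p - midpoint a b) \<in> interior (convex hull {a, b, c})"
    if t: "0 < t" "t < 1 / (1 + 2 * \<bar>u\<bar> + 2 * \<bar>v\<bar>)" for t
  proof -
    have "t * (1 + 2 * \<bar>u\<bar> + 2 * \<bar>v\<bar>) < 1"
      using t by (simp add: pos_less_divide_eq)
    then have t': "t + 2 * (t * \<bar>u\<bar>) + 2 * (t * \<bar>v\<bar>) < 1"
      by (simp add: algebra_simps)
    have "- (t * u) \<le> t * \<bar>u\<bar>" "- (t * v) \<le> t * \<bar>v\<bar>" "0 \<le> t * \<bar>u\<bar>" "0 \<le> t * \<bar>v\<bar>"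
      using t by (auto simp: abs_if)
    with t' have "0 < 1 - t + 2 * (t * u)" "0 < 1 - t + 2 * (t * v)"
      by linarith+
    then have "0 < (1 - t) / 2 + t * u" "0 < (1 - t) / 2 + t * v" "0 < t * w"
      using t(1) \<open>w > 0\<close> by (simp_all add: field_simps)
    moreover have "((1 - t) / 2 + t * u) + ((1 - t) / 2 + t * v) + t * w = 1"
    proof -
      have u: "u = 1 - v - w" using sum by simp
      show ?thesis unfolding u by (simp add: field_simps)
    qed
    moreover have "((1 - t) / 2 + t * u) *\<^sub>R a + ((1 - t) / 2 + t * v) *\<^sub>R b + (t * w) *\<^sub>R c =
        midpoint a b + t *\<^sub>R (p - midpoint a b)"
      unfolding p midpoint_def by (simp add: vec_eq_iff field_simps)
    ultimately show ?thesis
      unfolding interior_convex_hull_3_minimal[OF assms(1), simplified] mem_Collect_eq by blast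
  qed
  then show ?thesis
    by (intro exI[of _ "1 / (1 + 2 * \<bar>u\<bar> + 2 * \<bar>v\<bar>)"]) (auto simp: add_pos_nonneg)
qed

text \<open>A line that supports the convex domain at the midpoint of \<open>e\<close> contains \<open>e\<close>, and all triangles with
  edge \<open>e\<close> lie on its inner side. The ray from the midpoint to a point of the domain enters the interior of each of
  them, so two such triangles overlap, and conformity forces them to be equal.\<close>

lemma boundary_edge_in_unique_triangle:
  assumes \<Omega>: "convex_polygonal_domain \<Omega>"
    and \<T>: "triangulation \<T>" "\<Union>\<T> = closure \<Omega>"
    and T: "T \<in> \<T>" "2 simplex T" "e edge_of T"
    and T': "T' \<in> \<T>" "2 simplex T'" "e edge_of T'"
    and e: "e \<subseteq> frontier \<Omega>"
  shows "T = T'"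
proof -
  obtain a b c where abc: "e = closed_segment a b" "T = convex hull {a, b, c}" "\<not> collinear {a, b, c}"
    using edge_of_triangle_obtain_vertices[OF T(2,3)] .
  obtain a' b' c' where abc': "e = closed_segment a' b'" "T' = convex hull {a', b', c'}"
      "\<not> collinear {a', b', c'}"
    using edge_of_triangle_obtain_vertices[OF T'(2,3)] .
  have "{a', b'} = {a, b}"
    using abc(1) abc'(1) by (simp add: closed_segment_eq)
  then have T'_eq: "T' = convex hull {a, b, c'}" "\<not> collinear {a, b, c'}"
    using abc'(2,3) by (auto simp: doubleton_eq_iff insert_commute)
  let ?m = "midpoint a b"
  have \<Omega>': "open \<Omega>" "convex \<Omega>" "\<Omega> \<noteq> {}"
    using \<Omega> by (auto simp: convex_polygonal_domain_def)
  obtain p where "p \<in> \<Omega>" using \<Omega>'(3) by blast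
  have m: "?m \<in> frontier \<Omega>"
    using e abc(1) by auto
  have in_cl: "a \<in> closure \<Omega>" "b \<in> closure \<Omega>" "c \<in> closure \<Omega>" "c' \<in> closure \<Omega>"
    using abc(2) T'_eq(1) T(1) T'(1) \<T>(2) hull_subset[of "{a, b, c}"] hull_subset[of "{a, b, c'}"]
    by blast+
  have ri: "rel_interior \<Omega> = \<Omega>"
    using \<Omega>' by (simp add: rel_interior_open)
  obtain n where n: "\<And>y. y \<in> closure \<Omega> \<Longrightarrow> n \<bullet> ?m \<le> n \<bullet> y" "\<And>y. y \<in> \<Omega> \<Longrightarrow> n \<bullet> ?m < n \<bullet> y" "n \<noteq> 0"
  proof (rule supporting_hyperplane_relative_frontier[OF \<Omega>'(2), of ?m])
    show "?m \<in> closure \<Omega>" "?m \<notin> rel_interior \<Omega>"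
      using m \<Omega>'(1) unfolding ri by (auto simp: frontier_def interior_open)
  qed (use ri in blast)
  \<comment> \<open>A linear functional whose minimum over a segment is attained at the midpoint is constant on the segment.\<close>
  have "n \<bullet> ?m = (n \<bullet> a + n \<bullet> b) / 2"
    by (simp add: midpoint_def inner_add_right)
  then have nab: "n \<bullet> a = n \<bullet> ?m" "n \<bullet> b = n \<bullet> ?m"
    using n(1)[OF in_cl(1)] n(1)[OF in_cl(2)] by auto
  have apex: "n \<bullet> a < n \<bullet> z" if "z \<in> closure \<Omega>" "\<not> collinear {a, b, z}" for z
  proof -
    have "n \<bullet> z \<noteq> n \<bullet> ?m"
    proof
      assume "n \<bullet> z = n \<bullet> ?m"
      then have "{a, b, z} \<subseteq> {x. n \<bullet> x = n \<bullet> ?m}"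
        using nab by auto
      then have "aff_dim {a, b, z} \<le> aff_dim {x. n \<bullet> x = n \<bullet> ?m}"
        by (rule aff_dim_subset)
      then show False
        using that(2) n(3) by (simp add: aff_dim_hyperplane collinear_aff_dim)
    qed
    then show ?thesis using n(1)[OF that(1)] nab by simp
  qed
  obtain d where d: "d > 0" "\<And>t. 0 < t \<and> t < d \<Longrightarrow> ?m + t *\<^sub>R (p - ?m) \<in> interior T"
    using midpoint_ray_enters_triangle[OF abc(3), of n p] apex[OF in_cl(3) abc(3)] nab n(2)[OF \<open>p \<in> \<Omega>\<close>]
      abc(2) by auto
  obtain d' where d': "d' > 0" "\<And>t. 0 < t \<and> t < d' \<Longrightarrow> ?m + t *\<^sub>R (p - ?m) \<in> interior T'"
    using midpoint_ray_enters_triangle[OF T'_eq(2), of n p] apex[OF in_cl(4) T'_eq(2)] nab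
      n(2)[OF \<open>p \<in> \<Omega>\<close>] T'_eq(1) by auto
  define x where "x = ?m + (min d d' / 2) *\<^sub>R (p - ?m)"
  have x: "x \<in> interior T" "x \<in> interior T'"
    using d d' by (auto simp: x_def)
  \<comment> \<open>The intersection of the two triangles is a face of each; a face that meets the interior is the whole triangle.\<close>
  have absorb: "S \<inter> S' = S" if "S \<in> \<T>" "S' \<in> \<T>" "x \<in> interior S" "x \<in> interior S'" for S S'
  proof -
    have "S \<inter> S' face_of S"
      using \<T>(1) that(1,2) by (auto simp: triangulation_def)
    moreover have "S \<inter> S' \<inter> rel_interior S \<noteq> {}"
      using that(3,4) interior_subset interior_subset_rel_interior by blast
    ultimately show ?thesis
      using face_of_disjoint_rel_interior by blast
  qed
  show ?thesis
    using absorb[OF T(1) T'(1) x] absorb[OF T'(1) T(1) x(2,1)] by blast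
qed

section \<open>Arc length of boundary edges\<close>

lemma arc_length_finite:
  assumes "A \<in> sets borel" "polytope P" "F edge_of P"
  shows "arc_length F A < \<infinity>"
proof -
  obtain a b where "F = closed_segment a b"
    using edge_of_polytope_segment[OF assms(2,3)] by blast
  moreover have "emeasure lborel ({0..1} \<inter> linepath a b -` A) \<le> emeasure lborel {0..1::real}"
    by (intro emeasure_mono) auto
  then have "emeasure lborel ({0..1} \<inter> linepath a b -` A) < \<infinity>"
    by (rule le_less_trans) simp
  ultimately show ?thesis
    using assms(1) by (simp add: arc_length_closed_segment ennreal_mult_less_top)
qed

lemma finite_measure_boundary_measure:
  assumes "convex_polygonal_domain \<Omega>"
  shows "finite_measure (boundary_measure \<Omega>)"
proof
  have P: "polytope (closure \<Omega>)"
    using assms by (simp add: convex_polygonal_domain_def)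
  have "emeasure (boundary_measure \<Omega>) (frontier \<Omega>) = (\<Sum>F | F edge_of closure \<Omega>. arc_length F (frontier \<Omega>))"
    by (rule emeasure_boundary_measure[OF assms]) (auto simp: borel_closed)
  also have "\<dots> < \<infinity>"
    using finite_polytope_edges[OF P] arc_length_finite[OF borel_closed[OF frontier_closed] P] by simp
  finally show "emeasure (boundary_measure \<Omega>) (space (boundary_measure \<Omega>)) \<noteq> \<infinity>"
    by simp
qed

lemma arc_length_open_segment:
  assumes "a \<in> closed_segment c d" "b \<in> closed_segment c d"
  shows "ennreal (dist a b) \<le> arc_length (closed_segment c d) (open_segment a b)"
proof -
  obtain s t where st: "s \<in> {0..1}" "t \<in> {0..1}" "a = linepath c d s" "b = linepath c d t"
    using assms unfolding linepath_image_01[symmetric] by blast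
  have bor: "open_segment a b \<in> sets borel"
    unfolding open_segment_def by (simp add: borel_compact)
  have lp: "linepath c d s - linepath c d t = (t - s) *\<^sub>R (c - d)" for s t
    by (simp add: linepath_def algebra_simps)
  have dist: "dist a b = dist c d * \<bar>t - s\<bar>"
    unfolding st dist_norm lp by simp
  \<comment> \<open>\<open>s\<close> and \<open>t\<close> come in either order, so the parameters between them are written as \<open>open_segment s t\<close>.\<close>
  have sub: "open_segment s t \<subseteq> {0..1} \<inter> linepath c d -` open_segment a b" if "c \<noteq> d"
  proof
    fix r assume r: "r \<in> open_segment s t"
    then obtain u where u: "0 < u" "u < 1" "r = (1 - u) * s + u * t" "s \<noteq> t"
      by (auto simp: in_segment)
    have "linepath c d r = (1 - u) *\<^sub>R a + u *\<^sub>R b"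
      unfolding st u linepath_def by (simp add: algebra_simps)
    moreover have "a \<noteq> b"
      using dist \<open>c \<noteq> d\<close> u(4) by (metis abs_eq_0 dist_eq_0_iff mult_eq_0_iff right_minus_eq)
    ultimately have "linepath c d r \<in> open_segment a b"
      using u by (auto simp: in_segment)
    moreover have "r \<in> {0..1}"
      using r st(1,2) by (auto simp: open_segment_eq_real_ivl split: if_splits)
    ultimately show "r \<in> {0..1} \<inter> linepath c d -` open_segment a b" by simp
  qed
  show ?thesis
  proof (cases "c = d")
    case True
    then show ?thesis using dist by simp
  next
    case False
    have meas: "linepath c d \<in> borel_measurable borel"
      unfolding linepath_def by measurable
    have "ennreal \<bar>t - s\<bar> = emeasure lborel (open_segment s t)"
      by (auto simp: open_segment_eq_real_ivl abs_if)
    also have "\<dots> \<le> emeasure lborel ({0..1} \<inter> linepath c d -` open_segment a b)"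
      using sub[OF False] measurable_sets_borel[OF meas bor] by (intro emeasure_mono) auto
    finally show ?thesis
      unfolding arc_length_closed_segment[OF bor] dist by (simp add: ennreal_mult mult_left_mono)
  qed
qed

text \<open>The frontier is the union of the sides, so some side contains the midpoint; being a face, it contains
  the whole segment. This relates the edges of the mesh to the sides over which the arc length is summed.\<close>

lemma boundary_segment_in_side:
  assumes \<Omega>: "convex_polygonal_domain \<Omega>" and ab: "closed_segment a b \<subseteq> frontier \<Omega>"
  obtains F where "F edge_of closure \<Omega>" "a \<in> F" "b \<in> F"
proof -
  have \<Omega>': "open \<Omega>" "convex \<Omega>" "\<Omega> \<noteq> {}" "polytope (closure \<Omega>)"
    using \<Omega> by (auto simp: convex_polygonal_domain_def)
  have int: "interior (closure \<Omega>) = \<Omega>"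
    using \<Omega>' by (simp add: convex_interior_closure interior_open)
  then have "frontier \<Omega> = rel_frontier (closure \<Omega>)"
    using \<Omega>' by (simp add: rel_frontier_nonempty_interior) (simp add: frontier_def interior_open)
  moreover have "midpoint a b \<in> frontier \<Omega>"
    using ab by auto
  ultimately obtain F where F: "F facet_of closure \<Omega>" "midpoint a b \<in> F"
    using rel_frontier_of_polyhedron[OF polytope_imp_polyhedron[OF \<Omega>'(4)]] by blast
  have "aff_dim (closure \<Omega>) = 2"
    using int \<Omega>'(3) aff_dim_nonempty_interior[of "closure \<Omega>"] by simp
  then have edge: "F edge_of closure \<Omega>" and face: "F face_of closure \<Omega>"
    using F(1) by (auto simp: facet_of_def edge_of_def)
  have "a \<in> closure \<Omega>" "b \<in> closure \<Omega>"
    using ab by (auto simp: frontier_def)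
  moreover have "midpoint a b \<in> open_segment a b" if "a \<noteq> b"
    using that by (simp add: midpoint_in_open_segment)
  ultimately have "a \<in> F \<and> b \<in> F"
    using face F(2) unfolding face_of_def by (cases "a = b") (simp, blast)
  then show ?thesis using that edge by blast
qed

text \<open>Only the side that contains the segment is kept from the sum that defines the measure, so a lower
  bound results; this is the direction that the estimate of the control from below requires.\<close>

lemma boundary_measure_open_segment:
  assumes \<Omega>: "convex_polygonal_domain \<Omega>" and ab: "closed_segment a b \<subseteq> frontier \<Omega>"
  shows "ennreal (dist a b) \<le> emeasure (boundary_measure \<Omega>) (open_segment a b)"
proof -
  obtain F where F: "F edge_of closure \<Omega>" "a \<in> F" "b \<in> F"
    using boundary_segment_in_side[OF assms] .
  have P: "polytope (closure \<Omega>)"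
    using \<Omega> by (simp add: convex_polygonal_domain_def)
  obtain c d where cd: "F = closed_segment c d"
    using edge_of_polytope_segment[OF P F(1)] by blast
  have "arc_length F (open_segment a b) \<le> (\<Sum>F | F edge_of closure \<Omega>. arc_length F (open_segment a b))"
    using F(1) finite_polytope_edges[OF P] by (intro member_le_sum) auto
  also have "\<dots> = emeasure (boundary_measure \<Omega>) (open_segment a b)"
    using ab unfolding open_segment_def
    by (intro emeasure_boundary_measure[OF \<Omega>, symmetric]) (auto simp: borel_compact)
  finally show ?thesis
    using arc_length_open_segment[of a c d b] F(2,3) cd by (meson order_trans)
qed

section \<open>The control norm as a sum over edges\<close>

lemma sum_disjoint_le_integral:
  fixes f :: "'a \<Rightarrow> real"
  assumes "finite I" "disjoint_family_on S I" "\<And>i. i \<in> I \<Longrightarrow> S i \<in> sets M"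
    and fin: "finite_measure M" and int: "integrable M f" and nonneg: "AE x in M. 0 \<le> f x"
    and le: "\<And>i. i \<in> I \<Longrightarrow> AE x in M. x \<in> S i \<longrightarrow> c i \<le> f x"
  shows "(\<Sum>i\<in>I. c i * measure M (S i)) \<le> (\<integral>x. f x \<partial>M)"
proof -
  interpret finite_measure M by fact
  have ind: "integrable M (\<lambda>x. c i * indicator (S i) x)" if "i \<in> I" for i
    using assms(3)[OF that] by (simp add: emeasure_finite less_top[symmetric])
  have "(\<Sum>i\<in>I. c i * measure M (S i)) = (\<integral>x. (\<Sum>i\<in>I. c i * indicator (S i) x) \<partial>M)"
    using ind assms(3) by (subst Bochner_Integration.integral_sum) auto
  also have "\<dots> \<le> (\<integral>x. f x \<partial>M)"
  proof (rule integral_mono_AE)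
    show "integrable M (\<lambda>x. \<Sum>i\<in>I. c i * indicator (S i) x)"
      using ind by (rule Bochner_Integration.integrable_sum)
    have "AE x in M. \<forall>i\<in>I. x \<in> S i \<longrightarrow> c i \<le> f x"
      using le \<open>finite I\<close> by (simp add: AE_finite_all)
    then show "AE x in M. (\<Sum>i\<in>I. c i * indicator (S i) x) \<le> f x"
      using nonneg
    proof eventually_elim
      case (elim x)
      show ?case
      proof (cases "\<exists>j\<in>I. x \<in> S j")
        case True
        then obtain j where j: "j \<in> I" "x \<in> S j" by blast
        have "(\<Sum>i\<in>I. c i * indicator (S i) x) = (\<Sum>i\<in>I. if i = j then c j else 0)"
          using assms(2) j by (intro sum.cong) (auto simp: disjoint_family_on_def indicator_def)
        then show ?thesis using elim j \<open>finite I\<close> by simp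
      next
        case False
        then have "(\<Sum>i\<in>I. c i * indicator (S i) x) = 0"
          by (intro sum.neutral) (auto simp: indicator_def)
        then show ?thesis using elim by simp
      qed
    qed
  qed (use int in simp)
  finally show ?thesis .
qed

lemma in_L2_imp_integrable_abs:
  assumes "finite_measure M" "in_L2 M f"
  shows "integrable M (\<lambda>x. \<bar>f x\<bar>)"
proof (rule Bochner_Integration.integrable_bound)
  show "integrable M (\<lambda>x. 1 + (f x)\<^sup>2)"
    using assms by (auto simp: in_L2_def finite_measure.integrable_const)
  \<comment> \<open>\<open>1 - \<bar>y\<bar> + y\<^sup>2\<close> is \<open>(\<bar>y\<bar> - 1 / 2)\<^sup>2 + 3 / 4\<close>.\<close>
  have "\<bar>y\<bar> \<le> 1 + y\<^sup>2" for y :: real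
    using zero_le_power2[of "\<bar>y\<bar> - 1 / 2"] by (simp add: power2_diff power_divide)
  then show "AE x in M. norm \<bar>f x\<bar> \<le> norm (1 + (f x)\<^sup>2)"
    by (simp add: abs_of_nonneg add_nonneg_nonneg)
qed (use assms in \<open>auto simp: in_L2_def\<close>)

text \<open>The relative interiors of the boundary edges are disjoint and at least as large as the lengths of the
  edges, and the control is almost everywhere constant on each of them. The length of a segment \<open>e\<close> is written \<open>diameter e\<close>, which
  does not refer to its endpoints.\<close>

lemma control_L1_norm_ge:
  assumes \<Omega>: "convex_polygonal_domain \<Omega>"
    and \<T>: "triangulation \<T>" "\<forall>T\<in>\<T>. 2 simplex T"
    and u: "in_L2 (boundary_measure \<Omega>) u"
    and c: "\<And>e. e \<in> boundary_edges \<Omega> \<T> \<Longrightarrow> AE x in boundary_measure \<Omega>. x \<in> e \<longrightarrow> u x = c e"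
  shows "(\<Sum>e\<in>boundary_edges \<Omega> \<T>. diameter e * \<bar>c e\<bar>) \<le> L1_norm (boundary_measure \<Omega>) u"
proof -
  let ?M = "boundary_measure \<Omega>" and ?B = "boundary_edges \<Omega> \<T>"
  interpret finite_measure ?M
    by (rule finite_measure_boundary_measure[OF \<Omega>])
  have fin: "finite ?B"
    using finite_edges \<T> by (auto simp: boundary_edges_def triangulation_def)
  have seg: "rel_interior e \<in> sets ?M \<and> diameter e \<le> measure ?M (rel_interior e)" if e: "e \<in> ?B" for e
  proof -
    obtain a b where ab: "a \<noteq> b" "e = closed_segment a b"
      using edges_obtain_segment[OF \<T>(2)] e by (auto simp: boundary_edges_def)
    have fr: "closed_segment a b \<subseteq> frontier \<Omega>"
      using e ab by (auto simp: boundary_edges_def)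
    have ri: "rel_interior e = open_segment a b"
      using ab by (simp add: rel_interior_closed_segment)
    have "open_segment a b \<in> sets borel"
      unfolding open_segment_def by (simp add: borel_compact)
    moreover have "open_segment a b \<subseteq> frontier \<Omega>"
      using fr by (auto simp: open_segment_def)
    ultimately have "open_segment a b \<in> sets ?M"
      by (simp add: sets_restrict_space_iff)
    moreover have "dist a b \<le> measure ?M (open_segment a b)"
      using boundary_measure_open_segment[OF \<Omega> fr] by (simp add: emeasure_eq_measure)
    ultimately show ?thesis
      using ri by (simp add: ab(2) diameter_closed_segment)
  qed
  have "(\<Sum>e\<in>?B. diameter e * \<bar>c e\<bar>) \<le> (\<Sum>e\<in>?B. \<bar>c e\<bar> * measure ?M (rel_interior e))"
    using seg by (intro sum_mono) (metis abs_ge_zero mult.commute mult_left_mono)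
  also have "\<dots> \<le> (\<integral>x. \<bar>u x\<bar> \<partial>?M)"
  proof (rule sum_disjoint_le_integral[OF fin])
    show "disjoint_family_on rel_interior ?B"
      using distinct_edges_rel_interior_disjoint[OF \<T>(1)]
      by (auto simp: disjoint_family_on_def boundary_edges_def)
    show "integrable ?M (\<lambda>x. \<bar>u x\<bar>)"
      using in_L2_imp_integrable_abs[OF _ u] finite_measure_axioms by blast
    show "AE x in ?M. x \<in> rel_interior e \<longrightarrow> \<bar>c e\<bar> \<le> \<bar>u x\<bar>" if "e \<in> ?B" for e
      using c[OF that]
    proof eventually_elim
      case (elim x)
      then show ?case using rel_interior_subset[of e] by auto
    qed
  qed (use seg finite_measure_axioms in auto)
  finally show ?thesis
    by (simp add: L1_norm_def)
qed

section \<open>The lifting on a triangle\<close>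

text \<open>The elements of the Crouzeix-Raviart space are affine on a triangle only almost everywhere, whereas
  the midpoint condition is pointwise. The two descriptions agree at a midpoint: otherwise \<open>v\<close> and \<open>f\<close> would
  differ on the intersection of a punctured neighbourhood of \<open>m\<close> with the interior of \<open>T\<close>, and a nonempty open
  set is not negligible.\<close>

lemma continuous_limit_eq_AE_representative:
  fixes f v :: "'a::euclidean_space \<Rightarrow> real"
  assumes \<Omega>: "open \<Omega>" "convex \<Omega>"
    and T: "compact T" "convex T" "interior T \<noteq> {}" "T \<subseteq> closure \<Omega>" "m \<in> T"
    and ae: "AE x in lebesgue_on (T \<inter> \<Omega>). v x = f x"
    and f: "isCont f m"
    and v: "(v \<longlongrightarrow> v m) (at m within \<Omega>)"
  shows "v m = f m"
proof (rule ccontr)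
  assume "v m \<noteq> f m"
  have "((\<lambda>x. v x - f x) \<longlongrightarrow> v m - f m) (at m within \<Omega>)"
    using v f by (intro tendsto_diff) (auto simp: isCont_def intro: tendsto_within_subset)
  then have "\<forall>\<^sub>F x in at m within \<Omega>. v x - f x \<noteq> 0"
    by (rule tendsto_imp_eventually_ne) (use \<open>v m \<noteq> f m\<close> in simp)
  then obtain U where U: "open U" "m \<in> U" "\<And>x. x \<in> U \<Longrightarrow> x \<in> \<Omega> \<Longrightarrow> x \<noteq> m \<Longrightarrow> v x \<noteq> f x"
    unfolding eventually_at_topological by auto
  have inner: "interior T \<subseteq> \<Omega>"
    using interior_mono[OF T(4)] \<Omega> by (simp add: convex_interior_closure interior_open)
  \<comment> \<open>\<open>m\<close> may lie on the boundary of \<open>T\<close>, but every neighbourhood of it meets the interior of \<open>T\<close>.\<close>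
  define A where "A = U \<inter> interior T - {m}"
  have "m \<in> closure (interior T)"
    using T convex_closure_interior[of T] by (simp add: compact_imp_closed)
  then have "U \<inter> interior T \<noteq> {}"
    using U by (meson closure_iff_nhds_not_empty disjoint_iff order_refl)
  moreover have "U \<inter> interior T \<noteq> {m}"
    using U not_open_singleton[of m] by (metis open_Int open_interior)
  ultimately have "open A" "A \<noteq> {}"
    using U by (auto simp: A_def)
  have "T \<inter> \<Omega> \<in> sets lebesgue"
    using T(1) \<Omega>(1) by (intro sets.Int sets_completionI_sets) (auto simp: borel_compact)
  then have "AE x in lebesgue. x \<in> T \<inter> \<Omega> \<longrightarrow> v x = f x"
    using ae by (simp add: AE_restrict_space_iff)
  then obtain N where "negligible N" "{x. \<not> (x \<in> T \<inter> \<Omega> \<longrightarrow> v x = f x)} \<subseteq> N"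
    unfolding eventually_ae_filter_negligible by blast
  moreover have "A \<subseteq> {x. \<not> (x \<in> T \<inter> \<Omega> \<longrightarrow> v x = f x)}"
    using U inner interior_subset[of T] by (auto simp: A_def)
  ultimately have "negligible A"
    by (meson negligible_subset subset_trans)
  with \<open>open A\<close> \<open>A \<noteq> {}\<close> show False
    using open_not_negligible by blast
qed

lemma CR_affine_on_triangle:
  assumes \<Omega>: "convex_polygonal_domain \<Omega>"
    and \<T>: "\<Union>\<T> = closure \<Omega>" "T \<in> \<T>" "2 simplex T"
    and w: "w \<in> CR_space \<Omega> \<T>"
  obtains g d where "AE x in lebesgue_on (T \<inter> \<Omega>). w x = g \<bullet> x + d"
    "\<And>e. e edge_of T \<Longrightarrow> w (edge_midpoint e) = g \<bullet> edge_midpoint e + d"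
proof -
  obtain g d where ae: "AE x in lebesgue_on (T \<inter> \<Omega>). w x = g \<bullet> x + d"
    using w \<T>(2) unfolding CR_space_def by blast
  have "w (edge_midpoint e) = g \<bullet> edge_midpoint e + d" if e: "e edge_of T" for e
  proof (rule continuous_limit_eq_AE_representative[OF _ _ _ _ _ _ _ ae])
    show "open \<Omega>" "convex \<Omega>"
      using \<Omega> by (auto simp: convex_polygonal_domain_def)
    show "compact T" "convex T"
      using \<T>(3) compact_simplex convex_simplex by blast+
    have "aff_dim T = 2"
      using \<T>(3) by (rule aff_dim_simplex)
    then have "affine hull T = UNIV"
      using aff_dim_eq_full[of T] by simp
    moreover have "T \<noteq> {}" using \<open>aff_dim T = 2\<close> by auto
    ultimately show "interior T \<noteq> {}"
      using \<open>convex T\<close> rel_interior_eq_empty rel_interior_interior by metis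
    show "T \<subseteq> closure \<Omega>" using \<T> by auto
    obtain a b where "e = closed_segment a b"
      using edge_of_polytope_segment[OF simplex_imp_polytope[OF \<T>(3)] e] .
    then have "edge_midpoint e \<in> e" by simp
    then show "edge_midpoint e \<in> T"
      using edge_of_imp_subset[OF e] by blast
    show "(w \<longlongrightarrow> w (edge_midpoint e)) (at (edge_midpoint e) within \<Omega>)"
      using w e \<T>(2) unfolding CR_space_def edges_def by blast
  qed (intro continuous_intros)
  with ae show ?thesis by (rule that)
qed

text \<open>On \<open>T\<close> the lifting agrees with an affine function whose midpoint values are those of the lifting, and
  the three midpoint values bound that function.\<close>

lemma boundary_lifting_le_on_triangle:
  assumes \<Omega>: "convex_polygonal_domain \<Omega>"
    and \<T>: "\<Union>\<T> = closure \<Omega>" "\<forall>T\<in>\<T>. 2 simplex T" and T: "T \<in> \<T>"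
    and w: "boundary_lifting \<Omega> \<T> u w"
  shows "AE x in lebesgue_on \<Omega>. x \<in> T \<longrightarrow>
           \<bar>w x\<bar> \<le> (\<Sum>e | e \<in> boundary_edges \<Omega> \<T> \<and> e edge_of T. \<bar>w (edge_midpoint e)\<bar>)"
proof -
  have "2 simplex T" using \<T> T by auto
  have CR: "w \<in> CR_space \<Omega> \<T>" and zero: "\<And>e. e \<in> interior_edges \<Omega> \<T> \<Longrightarrow> w (edge_midpoint e) = 0"
    using w by (auto simp: boundary_lifting_def)
  obtain g d where ae: "AE x in lebesgue_on (T \<inter> \<Omega>). w x = g \<bullet> x + d"
    and mid: "\<And>e. e edge_of T \<Longrightarrow> w (edge_midpoint e) = g \<bullet> edge_midpoint e + d"
    using CR_affine_on_triangle[OF \<Omega> \<T>(1) T \<open>2 simplex T\<close> CR] by blast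
  obtain a b c where abc: "T = convex hull {a, b, c}" "\<not> collinear {a, b, c}"
    using triangle_obtain_vertices[OF \<open>2 simplex T\<close>] .
  let ?E = "{closed_segment a b, closed_segment b c, closed_segment c a}"
  have E: "{e. e edge_of T} = ?E"
    using edge_of_triangle_iff[OF abc(2)] abc(1) by auto
  have ne: "a \<noteq> b" "b \<noteq> c" "c \<noteq> a"
    using abc(2) by (auto simp: insert_commute)
  have bound: "\<bar>g \<bullet> x + d\<bar> \<le> (\<Sum>e | e \<in> boundary_edges \<Omega> \<T> \<and> e edge_of T. \<bar>w (edge_midpoint e)\<bar>)"
    if "x \<in> T" for x
  proof -
    have "\<bar>g \<bullet> x + d\<bar> \<le> \<bar>g \<bullet> midpoint a b + d\<bar> + \<bar>g \<bullet> midpoint b c + d\<bar> + \<bar>g \<bullet> midpoint c a + d\<bar>"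
      using that abc(1) affine_le_midpoint_values by blast
    also have "\<dots> = (\<Sum>e\<in>?E. \<bar>g \<bullet> edge_midpoint e + d\<bar>)"
      using ne by (simp add: closed_segment_eq doubleton_eq_iff)
    also have "\<dots> = (\<Sum>e | e edge_of T. \<bar>w (edge_midpoint e)\<bar>)"
      unfolding E[symmetric] using mid by (intro sum.cong) auto
    \<comment> \<open>The interior edges contribute nothing, since the lifting vanishes at their midpoints.\<close>
    also have "\<dots> = (\<Sum>e | e \<in> boundary_edges \<Omega> \<T> \<and> e edge_of T. \<bar>w (edge_midpoint e)\<bar>)"
    proof (rule sum.mono_neutral_right)
      show "finite {e. e edge_of T}" by (simp add: E)
      show "\<forall>e\<in>{e. e edge_of T} - {e. e \<in> boundary_edges \<Omega> \<T> \<and> e edge_of T}. \<bar>w (edge_midpoint e)\<bar> = 0"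
        using zero T by (auto simp: interior_edges_def edges_def)
    qed auto
    finally show ?thesis .
  qed
  have "open \<Omega>" using \<Omega> by (simp add: convex_polygonal_domain_def)
  then have "T \<inter> \<Omega> \<in> sets lebesgue" "\<Omega> \<in> sets lebesgue"
    using compact_simplex[OF \<open>2 simplex T\<close>]
    by (auto intro!: sets.Int sets_completionI_sets simp: borel_compact)
  then show ?thesis
    using ae bound by (auto simp: AE_restrict_space_iff elim!: eventually_mono)
qed

section \<open>The estimate\<close>

text \<open>The sets of \<open>\<T>\<close> may overlap, which makes the bound only larger because the constants are
  nonnegative.\<close>

lemma integral_le_sum_piecewise_bounds:
  fixes f :: "'a::euclidean_space \<Rightarrow> real"
  assumes "open \<Omega>" "finite \<T>" "\<Omega> \<subseteq> \<Union>\<T>" "\<And>T. T \<in> \<T> \<Longrightarrow> compact T" "\<And>T. T \<in> \<T> \<Longrightarrow> 0 \<le> K T"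
    and le: "\<And>T. T \<in> \<T> \<Longrightarrow> AE x in lebesgue_on \<Omega>. x \<in> T \<longrightarrow> f x \<le> K T"
  shows "(\<integral>x. f x \<partial>lebesgue_on \<Omega>) \<le> (\<Sum>T\<in>\<T>. K T * measure lebesgue T)"
proof -
  let ?M = "lebesgue_on \<Omega>"
  have sets: "T \<inter> \<Omega> \<in> sets ?M" "T \<inter> \<Omega> \<in> lmeasurable" "T \<in> lmeasurable" if "T \<in> \<T>" for T
    using assms(1) assms(4)[OF that] by (auto simp: sets_restrict_space_iff lmeasurable_compact lmeasurable_open
      intro!: sets.Int sets_completionI_sets borel_compact fmeasurable_Int_fmeasurable)
  have \<Omega>: "\<Omega> \<inter> space lebesgue \<in> sets lebesgue" using assms(1) by simp
  have meas: "emeasure ?M (T \<inter> \<Omega>) = emeasure lebesgue (T \<inter> \<Omega>)" for T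
    by (rule emeasure_restrict_space[OF \<Omega>]) auto
  have ind: "integrable ?M (\<lambda>x. K T * indicator (T \<inter> \<Omega>) x)" if "T \<in> \<T>" for T
    using sets[OF that] fmeasurableD2[of "T \<inter> \<Omega>" lebesgue]
    by (intro integrable_mult_right integrable_real_indicator) (auto simp: meas less_top)
  have "(\<integral>x. f x \<partial>?M) \<le> (\<integral>x. (\<Sum>T\<in>\<T>. K T * indicator (T \<inter> \<Omega>) x) \<partial>?M)"
  proof (rule integral_mono_AE')
    show "integrable ?M (\<lambda>x. \<Sum>T\<in>\<T>. K T * indicator (T \<inter> \<Omega>) x)"
      using ind by (rule Bochner_Integration.integrable_sum)
    have "AE x in ?M. \<forall>T\<in>\<T>. x \<in> T \<longrightarrow> f x \<le> K T"
      using le assms(2) by (simp add: AE_finite_all)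
    moreover have "AE x in ?M. x \<in> \<Omega>"
      using AE_space[of ?M] by simp
    ultimately show "AE x in ?M. f x \<le> (\<Sum>T\<in>\<T>. K T * indicator (T \<inter> \<Omega>) x)"
    proof eventually_elim
      case (elim x)
      then obtain T where T: "T \<in> \<T>" "x \<in> T" using assms(3) by blast
      then have "f x \<le> K T * indicator (T \<inter> \<Omega>) x"
        using elim by simp
      also have "\<dots> \<le> (\<Sum>T\<in>\<T>. K T * indicator (T \<inter> \<Omega>) x)"
        using T assms(2,5) by (intro member_le_sum) auto
      finally show ?case .
    qed
    show "AE x in ?M. 0 \<le> (\<Sum>T\<in>\<T>. K T * indicator (T \<inter> \<Omega>) x)"
      using assms(5) by (intro AE_I2 sum_nonneg) auto
  qed
  also have "\<dots> = (\<Sum>T\<in>\<T>. K T * measure ?M (T \<inter> \<Omega>))"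
    using ind sets by (subst Bochner_Integration.integral_sum) auto
  also have "\<dots> \<le> (\<Sum>T\<in>\<T>. K T * measure lebesgue T)"
  proof (intro sum_mono mult_left_mono assms(5))
    fix T assume "T \<in> \<T>"
    then show "measure ?M (T \<inter> \<Omega>) \<le> measure lebesgue T"
      using sets[of T] measure_mono_fmeasurable[of "T \<inter> \<Omega>" T lebesgue] 
      by (simp add: measure_def[of ?M] meas) (simp add: measure_def)
  qed
  finally show ?thesis .
qed

theorem theorem4p1:
  fixes \<Omega> :: "(real^2) set" and \<rho> :: real
  assumes "convex_polygonal_domain \<Omega>" and "\<rho> > 0"
  shows "\<exists>C>0. \<forall>\<T> u w.
           regular_triangulation \<rho> \<Omega> \<T> \<longrightarrow> u \<in> control_space \<Omega> \<T> \<longrightarrow>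
           boundary_lifting \<Omega> \<T> u w \<longrightarrow>
             L1_norm (lebesgue_on \<Omega>) w
               \<le> C * mesh_size \<T> * L1_norm (boundary_measure \<Omega>) u"
proof (intro exI[of _ "1 / 2"] conjI allI impI)
  fix \<T> u w
  assume reg: "regular_triangulation \<rho> \<Omega> \<T>" and u: "u \<in> control_space \<Omega> \<T>"
    and w: "boundary_lifting \<Omega> \<T> u w"
  have \<T>: "triangulation \<T>" "\<Union>\<T> = closure \<Omega>" "\<forall>T\<in>\<T>. 2 simplex T" and "finite \<T>"
    using reg by (auto simp: regular_triangulation_def triangulation_def)
  have "open \<Omega>" "\<Omega> \<noteq> {}" using assms(1) by (auto simp: convex_polygonal_domain_def)
  let ?h = "mesh_size \<T>" and ?B = "boundary_edges \<Omega> \<T>" and ?w = "\<lambda>e. \<bar>w (edge_midpoint e)\<bar>"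
  have h: "diameter T \<le> ?h" if "T \<in> \<T>" for T
    using that \<open>finite \<T>\<close> by (simp add: mesh_size_def)
  obtain T0 where "T0 \<in> \<T>"
    using \<T>(2) \<open>\<Omega> \<noteq> {}\<close> by (metis Sup_empty all_not_in_conv closure_eq_empty)
  then have "0 \<le> ?h"
    using h[of T0] \<T>(3) by (meson compact_imp_bounded compact_simplex diameter_ge_0 order_trans)
  have finB: "finite ?B"
    using finite_edges[OF \<open>finite \<T>\<close> \<T>(3)] by (simp add: boundary_edges_def)
  have diam: "0 \<le> diameter e" if "e \<in> ?B" for e
  proof -
    obtain a b where "e = closed_segment a b"
      using edges_obtain_segment[OF \<T>(3), of e] \<open>e \<in> ?B\<close> unfolding boundary_edges_def by blast
    then show ?thesis by (simp add: diameter_closed_segment)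
  qed
  have "L1_norm (lebesgue_on \<Omega>) w \<le> (\<Sum>T\<in>\<T>. (\<Sum>e | e \<in> ?B \<and> e edge_of T. ?w e) * measure lebesgue T)"
    unfolding L1_norm_def
  proof (rule integral_le_sum_piecewise_bounds[OF \<open>open \<Omega>\<close> \<open>finite \<T>\<close>])
    show "\<Omega> \<subseteq> \<Union>\<T>" using \<T>(2) closure_subset by auto
    show "compact T" if "T \<in> \<T>" for T
      using that \<T>(3) compact_simplex by blast
    show "AE x in lebesgue_on \<Omega>. x \<in> T \<longrightarrow> \<bar>w x\<bar> \<le> (\<Sum>e | e \<in> ?B \<and> e edge_of T. ?w e)" if "T \<in> \<T>" for T
      by (rule boundary_lifting_le_on_triangle[OF assms(1) \<T>(2,3) that w])
  qed (simp add: sum_nonneg)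
  also have "\<dots> = (\<Sum>T\<in>\<T>. \<Sum>e | e \<in> ?B \<and> e edge_of T. ?w e * measure lebesgue T)"
    by (simp add: sum_distrib_right)
  also have "\<dots> \<le> (\<Sum>T\<in>\<T>. \<Sum>e | e \<in> ?B \<and> e edge_of T. ?h / 2 * (diameter e * ?w e))"
  proof (intro sum_mono)
    fix T e assume T: "T \<in> \<T>" and e: "e \<in> {e. e \<in> ?B \<and> e edge_of T}"
    have "measure lebesgue T \<le> diameter T * diameter e / 2"
      using content_triangle_le_edge T e \<T>(3) by blast
    also have "\<dots> \<le> ?h * diameter e / 2"
      using h[OF T] diam e by (auto intro: mult_right_mono)
    finally have "?w e * measure lebesgue T \<le> ?w e * (?h * diameter e / 2)"
      by (rule mult_left_mono) simp
    then show "?w e * measure lebesgue T \<le> ?h / 2 * (diameter e * ?w e)"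
      by (simp add: mult_ac)
  qed
  \<comment> \<open>Collect the contributions by edge; each boundary edge then receives at most one.\<close>
  also have "\<dots> = (\<Sum>e\<in>?B. \<Sum>T | T \<in> \<T> \<and> e edge_of T. ?h / 2 * (diameter e * ?w e))"
    by (rule sum.swap_restrict[OF \<open>finite \<T>\<close> finB])
  also have "\<dots> \<le> (\<Sum>e\<in>?B. ?h / 2 * (diameter e * ?w e))"
  proof (rule sum_mono)
    fix e assume e: "e \<in> ?B"
    have "T = T'" if "T \<in> \<T>" "e edge_of T" "T' \<in> \<T>" "e edge_of T'" for T T'
      using boundary_edge_in_unique_triangle[OF assms(1) \<T>(1,2), of T e T'] that \<T>(3) e
      by (auto simp: boundary_edges_def)
    then have "card {T \<in> \<T>. e edge_of T} \<le> 1"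
      using \<open>finite \<T>\<close> by (auto simp: card_le_Suc0_iff_eq)
    then have "real (card {T \<in> \<T>. e edge_of T}) * (?h / 2 * (diameter e * ?w e)) \<le> ?h / 2 * (diameter e * ?w e)"
      using diam[OF e] \<open>0 \<le> ?h\<close> by (intro mult_left_le_one_le) auto
    then show "(\<Sum>T | T \<in> \<T> \<and> e edge_of T. ?h / 2 * (diameter e * ?w e)) \<le> ?h / 2 * (diameter e * ?w e)"
      by simp
  qed
  also have "\<dots> = ?h / 2 * (\<Sum>e\<in>?B. diameter e * ?w e)"
    by (simp add: sum_distrib_left)
  also have "\<dots> \<le> ?h / 2 * L1_norm (boundary_measure \<Omega>) u"
  proof (rule mult_left_mono)
    show "(\<Sum>e\<in>?B. diameter e * ?w e) \<le> L1_norm (boundary_measure \<Omega>) u"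
      using control_L1_norm_ge[OF assms(1) \<T>(1,3), of u "\<lambda>e. w (edge_midpoint e)"] u w
      by (auto simp: control_space_def boundary_lifting_def)
  qed (use \<open>0 \<le> ?h\<close> in simp)
  finally show "L1_norm (lebesgue_on \<Omega>) w \<le> 1 / 2 * ?h * L1_norm (boundary_measure \<Omega>) u"
    by simp
qed simp

end
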